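(* For every nonzero eigenvalue $\lambda$ of $\alpha_a$ on $B$, with generalized eigenspace $V_\lambda$, the trace $c_\lambda(1):=\operatorname{Tr}(\sigma\mid V_\lambda)$ is a rational integer.
   Context: Let $p$ prime, $q=p^a$, $f=\sum_u\bar c_ux^u\in\mathbb{F}_q[x_1^{\pm1},\dots,x_n^{\pm1}]$ ($\bar c_u\in\mathbb{F}_q^*$), $\mathbf d=(d_1,\dots,d_n)\in\mathbb{Z}_{\ge1}^n$, $d=\operatorname{lcm}(d_i)$, $N=\sum d_i$. Variables $y_{i,j}$ ($1\le i\le n$, $j\in\mathbb{Z}/d_i\mathbb{Z}$), $y^v=\prod y_{i,j}^{v_{i,j}}$; $\sigma(y_{i,j})=y_{i,j+1\bmod d_i}$ acting by $(\sigma\xi)(y)=\xi(\sigma y)$. $G(y)=\sum_{l=0}^{d-1}f(y_{1,l\bmod d_1},\dots,y_{n,l\bmod d_n})$; $\Delta$ = convex hull of $0$ and exponents of $G$; $M=\mathbb{R}_{\ge0}\Delta\cap\mathbb{Z}^N$; $w(u)=\inf\{\delta:u\in\delta\Delta\}$; $D$ with $w(M)\subseteq\frac1D\mathbb{Z}$. $\gamma$ a root of $\sum_{i\ge0}t^{p^i}/p^i$ with $\operatorname{ord}_p\gamma=1/(p-1)$; $K=\mathbb{Q}_q(\gamma^{1/D})$; $B=\{\sum_{u\in M}A_u\gamma^{w(u)}y^u:A_u\in K,|A_u|_p\to0\}$. $\theta(t)=E(\gamma t)$ ($E$ Artin–Hasse); with $c_u$ Teichmüller lifts and $\tau$ the Frobenius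 of $\mathbb{Q}_q$ on coefficients: $F(y)=\prod_{l=0}^{d-1}\prod_u\theta(c_u\prod_iy_{i,l\bmod d_i}^{u_i})$, $F_a(y)=\prod_{m=0}^{a-1}F^{\tau^m}(y^{p^m})$, $\psi_q(y^u)=y^{u/q}$ if $q$ divides all coordinates of $u$, else $0$; $\alpha_a=\psi_q\circ F_a$, a completely continuous operator on $B$ commuting with $\sigma$ (so $\sigma$ preserves each finite-dimensional generalized eigenspace $V_\lambda$, $\lambda\ne0$).
   Formalization: The exponents of G defining Δ are those of all monomials in the defining sum, including any that cancel mod p; otherwise, e.g. for d=(1,p), f=x_1+x_2, the operator α_a would not act on B. *)

theory Defs
  imports
    "HOL-Analysis.Analysis"
    "HOL-Analysis.Finite_Function_Topology"
    "HOL-Library.Poly_Mapping"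
    "HOL-Library.Function_Algebras"
    "HOL-Computational_Algebra.Formal_Power_Series"
begin

section \<open>Complete non-archimedean fields\<close>

text \<open>The library's \<open>norm\<close> is tied to real vector spaces, hence a separate absolute value \<open>vabs\<close>.\<close>

class complete_nonarch_field = field_char_0 + complete_space +
  fixes vabs :: "'a \<Rightarrow> real"
  assumes dist_vabs: "dist x y = vabs (x - y)"
    and vabs_mult: "vabs (x * y) = vabs x * vabs y"
    and vabs_add: "vabs (x + y) \<le> max (vabs x) (vabs y)"
begin

lemma vabs_minus: "vabs (- x) = vabs x"
  by (metis dist_vabs dist_commute diff_0 diff_0_right)

subclass topological_ab_group_add
proof
  fix a b :: 'a
  show "((\<lambda>x. fst x + snd x) \<longlongrightarrow> a + b) (nhds a \<times>\<^sub>F nhds b)"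
  proof (rule tendstoI)
    fix e :: real assume e: "0 < e"
    have "\<forall>\<^sub>F x in nhds a. dist x a < e" "\<forall>\<^sub>F y in nhds b. dist y b < e"
      using e by (auto simp: eventually_nhds_metric)
    then have "\<forall>\<^sub>F z in nhds a \<times>\<^sub>F nhds b. dist (fst z) a < e \<and> dist (snd z) b < e"
      unfolding eventually_prod_filter by auto
    then show "\<forall>\<^sub>F x in nhds a \<times>\<^sub>F nhds b. dist (fst x + snd x) (a + b) < e"
    proof eventually_elim
      case (elim z)
      have "dist (fst z + snd z) (a + b) = vabs ((fst z - a) + (snd z - b))"
        by (simp add: dist_vabs algebra_simps)
      also have "\<dots> < e"
        using elim vabs_add[of "fst z - a" "snd z - b"] by (auto simp: dist_vabs max_def split: if_splits)
      finally show ?case .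
    qed
  qed
  show "(uminus \<longlongrightarrow> - a) (nhds a)"
  proof (rule tendstoI)
    fix e :: real assume "0 < e"
    then have "\<forall>\<^sub>F x in nhds a. dist x a < e"
      by (auto simp: eventually_nhds_metric)
    then show "\<forall>\<^sub>F x in nhds a. dist (- x) (- a) < e"
    proof eventually_elim
      case (elim x)
      have "dist (- x) (- a) = vabs (- (x - a))"
        by (simp add: dist_vabs)
      also have "\<dots> = dist x a"
        by (simp only: vabs_minus dist_vabs)
      finally show ?case using elim by simp
    qed
  qed
qed

end

section \<open>The fields \<open>\<rat>\<^sub>p \<subseteq> \<rat>\<^sub>q \<subseteq> K\<close>, Teichmueller lifts and Frobenius\<close>

text \<open>All fields live inside a complete field \<open>'k\<close> whose absolute value \<open>vabs\<close> is \<open>\<bar>\<cdot>\<bar>\<^sub>p\<close>.\<close>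

definition is_subfield :: "'k::field set \<Rightarrow> bool" where
  "is_subfield S \<longleftrightarrow> 0 \<in> S \<and> 1 \<in> S \<and>
     (\<forall>x\<in>S. \<forall>y\<in>S. x - y \<in> S \<and> x * y \<in> S \<and> inverse x \<in> S)"

definition Q_p :: "'k::complete_nonarch_field set" where
  "Q_p = closure (range of_rat)"

text \<open>The unramified extension of \<open>\<rat>\<^sub>p\<close> of degree \<open>a\<close>, where \<open>q = p ^ a\<close>.\<close>

definition Q_q :: "nat \<Rightarrow> 'k::complete_nonarch_field set" where
  "Q_q q = is_subfield hull (Q_p \<union> {z. z ^ (q - 1) = 1})"

text \<open>Here \<open>\<pi>\<close> is the chosen root \<open>\<gamma>\<^bsup>1/D\<^esup>\<close>.\<close>

definition K_field :: "nat \<Rightarrow> 'k \<Rightarrow> 'k::complete_nonarch_field set" where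
  "K_field q \<pi> = is_subfield hull (insert \<pi> (Q_q q))"

text \<open>\<open>red\<close> identifies the residue field of \<open>\<rat>\<^sub>q\<close> with the finite field \<open>'f\<close>.\<close>

definition is_reduction :: "nat \<Rightarrow> ('k::complete_nonarch_field \<Rightarrow> 'f::field) \<Rightarrow> bool" where
  "is_reduction q red \<longleftrightarrow> (let R = {x \<in> Q_q q. vabs x \<le> 1} in
     red 1 = 1 \<and>
     (\<forall>x\<in>R. \<forall>y\<in>R. red (x + y) = red x + red y \<and> red (x * y) = red x * red y) \<and>
     (\<forall>x\<in>R. red x = 0 \<longleftrightarrow> vabs x < 1) \<and>
     red ` R = UNIV)"

definition teichmueller :: "nat \<Rightarrow> ('k::complete_nonarch_field \<Rightarrow> 'f::field) \<Rightarrow> 'f \<Rightarrow> 'k" where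
  "teichmueller q red c = (THE x. x \<in> Q_q q \<and> x ^ q = x \<and> red x = c)"

text \<open>
  The Frobenius of \<open>\<rat>\<^sub>q\<close>, extended to \<open>K = \<rat>\<^sub>q(\<pi>)\<close> by \<open>\<tau> \<pi> = \<pi>\<close>. This extension exists, since
  \<open>\<rat>\<^sub>p(\<pi>)\<close> is totally ramified, and it is needed because the coefficients of \<open>F\<close> involve \<open>\<gamma>\<close>.
\<close>

definition is_frobenius ::
  "nat \<Rightarrow> nat \<Rightarrow> 'k::complete_nonarch_field \<Rightarrow> ('k \<Rightarrow> 'k) \<Rightarrow> bool" where
  "is_frobenius p q \<pi> \<tau> \<longleftrightarrow>
     bij_betw \<tau> (K_field q \<pi>) (K_field q \<pi>) \<and>
     (\<forall>x\<in>K_field q \<pi>. \<forall>y\<in>K_field q \<pi>. \<tau> (x + y) = \<tau> x + \<tau> y \<and> \<tau> (x * y) = \<tau> x * \<tau> y) \<and>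
     (\<forall>x\<in>K_field q \<pi>. vabs (\<tau> x) = vabs x) \<and>
     \<tau> ` Q_q q = Q_q q \<and>
     (\<forall>x\<in>Q_q q. vabs x \<le> 1 \<longrightarrow> vabs (\<tau> x - x ^ p) < 1) \<and>
     \<tau> \<pi> = \<pi>"

section \<open>Exponents, the polytope, the weight\<close>

text \<open>
  Exponent vectors of the variables \<open>x\<^sub>i\<close> and \<open>y\<^sub>i\<^sub>,\<^sub>j\<close> are finitely supported functions on the set
  of indices \<open>i\<close>, respectively of pairs \<open>(i, j)\<close>; indices start at 0, and \<open>\<int>/d\<^sub>i\<int>\<close> is \<open>{..<d\<^sub>i}\<close>.
  A Laurent polynomial is a finitely supported function on exponent vectors.
\<close>

type_synonym xexp = "nat \<Rightarrow>\<^sub>0 int"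
type_synonym yexp = "nat \<times> nat \<Rightarrow>\<^sub>0 int"
type_synonym 'k yseries = "yexp \<Rightarrow> 'k"

definition lcm_d :: "nat \<Rightarrow> (nat \<Rightarrow> nat) \<Rightarrow> nat" where
  "lcm_d n d = Lcm (d ` {..<n})"

definition yexps :: "nat \<Rightarrow> (nat \<Rightarrow> nat) \<Rightarrow> yexp set" where
  "yexps n d = {v. Poly_Mapping.keys v \<subseteq> (SIGMA i:{..<n}. {..<d i})}"

text \<open>The exponent of \<open>\<Prod>\<^sub>i y\<^sub>i\<^sub>,\<^sub>l\<^sub>m\<^sub>o\<^sub>d\<^sub>d\<^sub>i\<close> raised to the \<open>u\<^sub>i\<close>.\<close>

definition sub_exp :: "(nat \<Rightarrow> nat) \<Rightarrow> nat \<Rightarrow> xexp \<Rightarrow> yexp" where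
  "sub_exp d l u =
     (\<Sum>i\<in>Poly_Mapping.keys u. Poly_Mapping.single (i, l mod d i) (Poly_Mapping.lookup u i))"

text \<open>
  The exponents of \<open>G\<close> are those of the monomials occurring in the sum that defines \<open>G\<close> (equivalently,
  those of its Teichmueller lift, in which nothing cancels). Equal monomials from different \<open>l\<close>
  have equal coefficients, and they may add up to 0 in characteristic \<open>p\<close>; deleting them from \<open>\<Delta>\<close>
  would take the exponents of \<open>F\<close> out of the cone, and \<open>\<alpha>\<^sub>a\<close> would not act on \<open>B\<close>.
\<close>

definition G_exps :: "nat \<Rightarrow> (nat \<Rightarrow> nat) \<Rightarrow> (xexp \<Rightarrow>\<^sub>0 'f::field) \<Rightarrow> yexp set" where
  "G_exps n d f = (\<Union>l<lcm_d n d. sub_exp d l ` Poly_Mapping.keys f)"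

definition real_exp :: "yexp \<Rightarrow> (nat \<times> nat \<Rightarrow>\<^sub>0 real)" where
  "real_exp = Poly_Mapping.map real_of_int"

definition Delta :: "nat \<Rightarrow> (nat \<Rightarrow> nat) \<Rightarrow> (xexp \<Rightarrow>\<^sub>0 'f::field) \<Rightarrow> (nat \<times> nat \<Rightarrow>\<^sub>0 real) set" where
  "Delta n d f = convex hull (insert 0 (real_exp ` G_exps n d f))"

definition cone_points :: "(nat \<times> nat \<Rightarrow>\<^sub>0 real) set \<Rightarrow> yexp set" where
  "cone_points \<Delta> = {u. \<exists>\<delta>\<ge>0. real_exp u \<in> (*\<^sub>R) \<delta> ` \<Delta>}"

definition weight :: "(nat \<times> nat \<Rightarrow>\<^sub>0 real) set \<Rightarrow> yexp \<Rightarrow> real" where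
  "weight \<Delta> u = Inf {\<delta>. 0 \<le> \<delta> \<and> real_exp u \<in> (*\<^sub>R) \<delta> ` \<Delta>}"

section \<open>Series\<close>

text \<open>A series \<open>\<Sum>\<^sub>u \<xi>\<^sub>u y\<^sup>u\<close> is the function \<open>\<xi>\<close>.\<close>

text \<open>
  \<open>\<gamma>\<^bsup>w(u)\<^esup>\<close> is \<open>\<pi>\<^bsup>D w(u)\<^esup>\<close>. The coefficients \<open>A\<^sub>u\<close> range over the whole type \<open>'k\<close>: this is \<open>B\<close> itself
  if \<open>'k\<close> is \<open>K\<close>, and its scalar extension to \<open>'k\<close> if \<open>'k\<close> is a larger complete field, as needed for
  eigenvalues outside \<open>K\<close>.
\<close>

definition B_space ::
  "(nat \<times> nat \<Rightarrow>\<^sub>0 real) set \<Rightarrow> nat \<Rightarrow> 'k::complete_nonarch_field \<Rightarrow> 'k yseries set" where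
  "B_space \<Delta> D \<pi> = {\<xi>. \<exists>A.
     (\<forall>u\<in>cone_points \<Delta>. \<xi> u = A u * \<pi> ^ nat \<lfloor>real D * weight \<Delta> u\<rfloor>) \<and>
     (\<forall>u. u \<notin> cone_points \<Delta> \<longrightarrow> \<xi> u = 0) \<and>
     (\<forall>\<epsilon>>0. finite {u \<in> cone_points \<Delta>. \<epsilon> \<le> vabs (A u)})}"

definition series_mult :: "'k::complete_nonarch_field yseries \<Rightarrow> 'k yseries \<Rightarrow> 'k yseries" where
  "series_mult \<xi> \<eta> v = (\<Sum>\<^sub>\<infinity>u. \<xi> u * \<eta> (v - u))"

text \<open>The product of a finite family of series, expanded over all ways of choosing one term in each.\<close>

definition series_prod ::
  "'i set \<Rightarrow> ('i \<Rightarrow> 'k::complete_nonarch_field yseries) \<Rightarrow> 'k yseries" where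
  "series_prod I g v = (\<Sum>\<^sub>\<infinity>s\<in>{s \<in> I \<rightarrow>\<^sub>E UNIV. (\<Sum>i\<in>I. s i) = v}. \<Prod>i\<in>I. g i (s i))"

text \<open>The substitution \<open>y\<^sup>v \<mapsto> y\<^bsup>h(v)\<^esup>\<close>, for \<open>h\<close> injective on the exponents.\<close>

definition series_subst ::
  "yexp set \<Rightarrow> (yexp \<Rightarrow> yexp) \<Rightarrow> 'k::complete_nonarch_field yseries \<Rightarrow> 'k yseries" where
  "series_subst E h \<xi> w = (\<Sum>v\<in>{v \<in> E. h v = w}. \<xi> v)"

text \<open>The series \<open>g (c y\<^sup>e)\<close> for a one-variable power series \<open>g\<close>.\<close>

definition fps_at_monomial ::
  "'k::complete_nonarch_field fps \<Rightarrow> 'k \<Rightarrow> yexp \<Rightarrow> 'k yseries" where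
  "fps_at_monomial g c e v = (\<Sum>\<^sub>\<infinity>k\<in>{k. frag_cmul (int k) e = v}. fps_nth g k * c ^ k)"

definition artin_hasse :: "nat \<Rightarrow> 'k::field_char_0 fps" where
  "artin_hasse p = fps_compose (fps_exp 1)
     (Abs_fps (\<lambda>k. if \<exists>i. k = p ^ i then 1 / of_nat k else 0))"

definition theta :: "nat \<Rightarrow> 'k \<Rightarrow> 'k::field_char_0 fps" where
  "theta p \<gamma> = fps_compose (artin_hasse p) (fps_const \<gamma> * fps_X)"

definition F_series ::
  "nat \<Rightarrow> nat \<Rightarrow> nat \<Rightarrow> (nat \<Rightarrow> nat) \<Rightarrow> (xexp \<Rightarrow>\<^sub>0 'f::field) \<Rightarrow>
   ('k::complete_nonarch_field \<Rightarrow> 'f) \<Rightarrow> 'k \<Rightarrow> 'k yseries" where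
  "F_series p q n d f red \<gamma> =
     series_prod ({..<lcm_d n d} \<times> Poly_Mapping.keys f)
       (\<lambda>(l, u). fps_at_monomial (theta p \<gamma>)
          (teichmueller q red (Poly_Mapping.lookup f u)) (sub_exp d l u))"

definition F_a_series ::
  "nat \<Rightarrow> nat \<Rightarrow> nat \<Rightarrow> (nat \<Rightarrow> nat) \<Rightarrow> (xexp \<Rightarrow>\<^sub>0 'f::field) \<Rightarrow>
   ('k::complete_nonarch_field \<Rightarrow> 'f) \<Rightarrow> 'k \<Rightarrow> ('k \<Rightarrow> 'k) \<Rightarrow> 'k yseries" where
  "F_a_series p a n d f red \<gamma> \<tau> =
     series_prod {..<a} (\<lambda>m. series_subst (yexps n d) (frag_cmul (int (p ^ m)))
       (\<lambda>v. (\<tau> ^^ m) (F_series p (p ^ a) n d f red \<gamma> v)))"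

definition psi :: "nat \<Rightarrow> 'k::complete_nonarch_field yseries \<Rightarrow> 'k yseries" where
  "psi q \<xi> u = \<xi> (frag_cmul (int q) u)"

definition alpha ::
  "nat \<Rightarrow> nat \<Rightarrow> nat \<Rightarrow> (nat \<Rightarrow> nat) \<Rightarrow> (xexp \<Rightarrow>\<^sub>0 'f::field) \<Rightarrow>
   ('k::complete_nonarch_field \<Rightarrow> 'f) \<Rightarrow> 'k \<Rightarrow> ('k \<Rightarrow> 'k) \<Rightarrow> 'k yseries \<Rightarrow> 'k yseries" where
  "alpha p a n d f red \<gamma> \<tau> \<xi> = psi (p ^ a) (series_mult (F_a_series p a n d f red \<gamma> \<tau>) \<xi>)"

text \<open>\<open>\<sigma> (y\<^sup>v) = y\<^bsup>shift_exp d v\<^esup>\<close>\<close>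

definition shift_exp :: "(nat \<Rightarrow> nat) \<Rightarrow> yexp \<Rightarrow> yexp" where
  "shift_exp d v = (\<Sum>(i, j)\<in>Poly_Mapping.keys v.
     Poly_Mapping.single (i, (j + 1) mod d i) (Poly_Mapping.lookup v (i, j)))"

definition sigma_op ::
  "nat \<Rightarrow> (nat \<Rightarrow> nat) \<Rightarrow> 'k::complete_nonarch_field yseries \<Rightarrow> 'k yseries" where
  "sigma_op n d = series_subst (yexps n d) (shift_exp d)"

section \<open>Generalized eigenspaces and traces\<close>

definition series_scale :: "'k::complete_nonarch_field \<Rightarrow> 'k yseries \<Rightarrow> 'k yseries" where
  "series_scale c \<xi> = (\<lambda>v. c * \<xi> v)"

interpretation series: vector_space series_scale
  by unfold_locales (auto simp: series_scale_def fun_eq_iff algebra_simps)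

definition is_eigenvalue ::
  "('k::complete_nonarch_field yseries \<Rightarrow> 'k yseries) \<Rightarrow> 'k yseries set \<Rightarrow> 'k \<Rightarrow> bool" where
  "is_eigenvalue T V c \<longleftrightarrow> (\<exists>\<xi>\<in>V. \<xi> \<noteq> 0 \<and> T \<xi> = series_scale c \<xi>)"

definition gen_eigenspace ::
  "('k::complete_nonarch_field yseries \<Rightarrow> 'k yseries) \<Rightarrow> 'k yseries set \<Rightarrow> 'k \<Rightarrow> 'k yseries set" where
  "gen_eigenspace T V c = {\<xi> \<in> V. \<exists>k. ((\<lambda>\<eta>. T \<eta> - series_scale c \<eta>) ^^ k) \<xi> = 0}"

text \<open>
  The trace of \<open>T\<close> on a finite-dimensional \<open>T\<close>-stable subspace \<open>V\<close>: the sum of the diagonal matrix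
  entries in a basis. By the convention for sums over infinite sets it is 0 in infinite dimension,
  which does not occur for nonzero eigenvalues of a completely continuous operator.
\<close>

definition trace_on ::
  "('k::complete_nonarch_field yseries \<Rightarrow> 'k yseries) \<Rightarrow> 'k yseries set \<Rightarrow> 'k" where
  "trace_on T V =
     (let S = (SOME S. S \<subseteq> V \<and> series.independent S \<and> V \<subseteq> series.span S)
      in \<Sum>b\<in>S. series.representation S (T b) b)"

end

theory Submission
  imports Defs "HOL-Number_Theory.Cong"
begin

text \<open>
  For \<open>k\<close> coprime to \<open>L = lcm d\<^sub>i\<close>, the substitution \<open>\<rho>\<^sub>k\<close> sending \<open>y\<^sub>i\<^sub>,\<^sub>j\<close> to \<open>y\<^sub>i\<^sub>,\<^sub>k\<^sub>j\<close> only permutes the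
  factors of \<open>F\<close>, because multiplication by \<open>k\<close> permutes the residues modulo \<open>L\<close>. So \<open>\<rho>\<^sub>k\<close> commutes
  with \<open>\<alpha>\<close>, acts on the generalized eigenspace, and conjugates \<open>\<sigma>\<close> into \<open>\<sigma>\<^sup>k\<close> there; thus all
  generators of the cyclic group of order \<open>L\<close> have the same trace \<open>r\<close>. The traces of the generators in
  any representation add up to an integer, since sums over subgroups are multiples of traces of
  idempotents. Applied to the \<open>N\<close>-th tensor power, the number \<open>c\<close> of generators satisfies
  \<open>c r\<^sup>N \<in> \<int>\<close> for every \<open>N\<close>, which forces \<open>r \<in> \<int>\<close>. The symmetries reindex the sums
  defining \<open>\<alpha>\<close>, so they commute with \<open>\<alpha>\<close> regardless of convergence.
\<close>

section \<open>Traces of cyclic group representations\<close>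

definition mmul :: "'i set \<Rightarrow> ('i \<Rightarrow> 'i \<Rightarrow> 'k::comm_ring_1) \<Rightarrow> ('i \<Rightarrow> 'i \<Rightarrow> 'k) \<Rightarrow> 'i \<Rightarrow> 'i \<Rightarrow> 'k" where
  "mmul I M M' i j = (\<Sum>l\<in>I. M i l * M' l j)"

definition mtrace :: "'i set \<Rightarrow> ('i \<Rightarrow> 'i \<Rightarrow> 'k::comm_ring_1) \<Rightarrow> 'k" where
  "mtrace I M = (\<Sum>i\<in>I. M i i)"

lemma mtrace_mmul_commute: "mtrace I (mmul I M M') = mtrace I (mmul I M' M)"
  unfolding mtrace_def mmul_def by (subst sum.swap) (simp add: mult.commute)

lemma sum_fun_apply: "(\<Sum>a\<in>A. h a) x = (\<Sum>a\<in>A. h a x)"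
  by (induction A rule: infinite_finite_induct) simp_all

lemma mtrace_idempotent_in_Ints:
  fixes E :: "'i \<Rightarrow> 'i \<Rightarrow> 'k::field"
  assumes I: "finite I" and idem: "\<And>i j. i \<in> I \<Longrightarrow> j \<in> I \<Longrightarrow> mmul I E E i j = E i j"
  shows "mtrace I E \<in> \<int>"
proof -
  \<comment> \<open>Rank factorization: if \<open>S\<close> is a basis of the column space, \<open>E = U V\<close> with \<open>U\<close> the columns in
    \<open>S\<close> and \<open>V\<close> the coordinates; \<open>E\<^sup>2 = E\<close> gives \<open>V U = 1\<close>, so the trace is \<open>card S\<close>.\<close>
  interpret vector_space "\<lambda>(c::'k) (v::'i \<Rightarrow> 'k) i. c * v i"
    by unfold_locales (auto simp: fun_eq_iff algebra_simps)
  \<comment> \<open>Cutting the columns off outside \<open>I\<close> turns identities between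
    entries with indices in \<open>I\<close> into equalities of vectors.\<close>
  define col where "col j = (\<lambda>i. if i \<in> I then E i j else 0)" for j
  obtain S where S: "S \<subseteq> col ` I" "independent S" "col ` I \<subseteq> span S"
    using maximal_independent_subset by blast
  have fin: "finite S" using S(1) I finite_surj by blast
  have expand: "col j i = (\<Sum>s\<in>S. representation S (col j) s * s i)" if "j \<in> I" for i j
  proof -
    have "(\<Sum>s\<in>S. (\<lambda>i. representation S (col j) s * s i)) = col j"
      using sum_representation_eq[OF S(2) _ fin order_refl, of "col j"] S(3) that by auto
    then have "col j i = (\<Sum>s\<in>S. (\<lambda>i. representation S (col j) s * s i)) i" by simp
    then show ?thesis by (simp add: sum_fun_apply)
  qed
  \<comment> \<open>These are the diagonal entries of \<open>V U\<close>: a column \<open>s\<close>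
    of the idempotent \<open>E\<close> satisfies \<open>E s = s\<close>, and the coordinate at
    \<open>s\<close> is read off on both sides.\<close>
  have fix1: "(\<Sum>i\<in>I. s i * representation S (col i) s) = 1" if s: "s \<in> S" for s
  proof -
    obtain j where j: "j \<in> I" "s = col j" using subsetD[OF S(1) s] by auto
    have "s = (\<Sum>l\<in>I. (\<lambda>i. s l * col l i))"
    proof
      fix i
      have "(\<Sum>l\<in>I. s l * col l i) = (if i \<in> I then mmul I E E i j else 0)"
        by (auto simp: j(2) col_def mmul_def mult.commute intro!: sum.cong)
      then show "s i = (\<Sum>l\<in>I. (\<lambda>i. s l * col l i)) i"
        using j idem by (simp add: sum_fun_apply col_def)
    qed
    then have "representation S s = representation S (\<Sum>l\<in>I. (\<lambda>i. s l * col l i))" by simp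
    also have "\<dots> = (\<lambda>b. \<Sum>l\<in>I. representation S (\<lambda>i. s l * col l i) b)"
      by (rule representation_sum[OF S(2)]) (use S(3) span_scale in blast)
    also have "\<dots> = (\<lambda>b. \<Sum>l\<in>I. s l * representation S (col l) b)"
      using S(3) by (intro ext sum.cong refl) (subst representation_scale[OF S(2)], auto)
    finally show ?thesis
      using fun_cong[of "representation S s" _ s] representation_basis[OF S(2) s] by metis
  qed
  have "mtrace I E = (\<Sum>i\<in>I. col i i)" by (simp add: mtrace_def col_def)
  also have "\<dots> = (\<Sum>i\<in>I. \<Sum>s\<in>S. representation S (col i) s * s i)"
    by (intro sum.cong refl expand)
  also have "\<dots> = (\<Sum>s\<in>S. \<Sum>i\<in>I. s i * representation S (col i) s)"
    by (subst sum.swap) (simp add: mult.commute)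
  also have "\<dots> = of_nat (card S)" using fix1 by simp
  finally show ?thesis by simp
qed

text \<open>A representation of \<open>\<int>/d\<int>\<close> as a \<open>d\<close>-periodic family \<open>M\<close> of matrices, meaningful on \<open>I\<close> only.\<close>

definition cyclic_rep :: "nat \<Rightarrow> 'i set \<Rightarrow> (nat \<Rightarrow> 'i \<Rightarrow> 'i \<Rightarrow> 'k::comm_ring_1) \<Rightarrow> bool" where
  "cyclic_rep d I M \<longleftrightarrow> finite I \<and> d > 0 \<and>
     (\<forall>k l. \<forall>i\<in>I. \<forall>j\<in>I. mmul I (M k) (M l) i j = M (k + l) i j) \<and>
     (\<forall>k. \<forall>i\<in>I. \<forall>j\<in>I. M (k + d) i j = M k i j)"

lemma sum_periodic_shift:
  fixes h :: "nat \<Rightarrow> 'b::ab_group_add"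
  assumes "\<And>k. h (k + d) = h k"
  shows "(\<Sum>k<d. h (m + k)) = (\<Sum>k<d. h k)"
proof (induction m)
  case (Suc m)
  have "(\<Sum>k<d. h (Suc m + k)) + h m = (\<Sum>k<Suc d. h (m + k))"
    by (subst sum.lessThan_Suc_shift) simp
  also have "\<dots> = (\<Sum>k<d. h (m + k)) + h m" using assms[of m] by simp
  finally show ?case using Suc by simp
qed simp

text \<open>The average of the matrices over the group is idempotent, so its trace is an integer;
  the sum of the traces is \<open>d\<close> times that integer.\<close>

lemma cyclic_rep_sum_mtrace:
  fixes M :: "nat \<Rightarrow> 'i \<Rightarrow> 'i \<Rightarrow> 'k::field_char_0"
  assumes "cyclic_rep d I M"
  shows "(\<Sum>k<d. mtrace I (M k)) \<in> \<int>"
proof -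
  note r = assms[unfolded cyclic_rep_def]
  have fin: "finite I" and d: "d > 0"
    and mul: "\<And>k l i j. i \<in> I \<Longrightarrow> j \<in> I \<Longrightarrow> mmul I (M k) (M l) i j = M (k + l) i j"
    and per: "\<And>k i j. i \<in> I \<Longrightarrow> j \<in> I \<Longrightarrow> M (k + d) i j = M k i j"
    using r by auto
  define E where "E i j = (\<Sum>k<d. M k i j) / of_nat d" for i j
  have "mmul I E E i j = E i j" if ij: "i \<in> I" "j \<in> I" for i j
  proof -
    have "mmul I E E i j = (\<Sum>l\<in>I. \<Sum>k<d. \<Sum>k'<d. M k i l * M k' l j) / (of_nat d)\<^sup>2"
      by (simp add: mmul_def E_def sum_product power2_eq_square sum_divide_distrib)
    also have "(\<Sum>l\<in>I. \<Sum>k<d. \<Sum>k'<d. M k i l * M k' l j) = (\<Sum>k<d. \<Sum>l\<in>I. \<Sum>k'<d. M k i l * M k' l j)"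
      by (rule sum.swap)
    also have "\<dots> = (\<Sum>k<d. \<Sum>k'<d. \<Sum>l\<in>I. M k i l * M k' l j)"
      by (intro sum.cong refl sum.swap)
    also have "\<dots> = (\<Sum>k<d. \<Sum>k'<d. M (k + k') i j)"
      using mul[OF ij] by (simp add: mmul_def)
    \<comment> \<open>Translation by \<open>k\<close> permutes the group, so the inner sum does not
      depend on \<open>k\<close>.\<close>
    also have "\<dots> = (\<Sum>k<d. \<Sum>k'<d. M k' i j)"
      by (intro sum.cong refl sum_periodic_shift) (rule per[OF ij])
    finally have "mmul I E E i j = (\<Sum>k<d. \<Sum>k'<d. M k' i j) / (of_nat d)\<^sup>2" .
    then show ?thesis using d by (simp add: E_def[of i j] power2_eq_square)
  qed
  then have "mtrace I E \<in> \<int>" by (intro mtrace_idempotent_in_Ints fin)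
  moreover have "(\<Sum>k<d. mtrace I (M k)) = of_nat d * mtrace I E"
    using d by (simp add: mtrace_def E_def sum.swap[of _ "{..<d}"] flip: sum_divide_distrib)
  ultimately show ?thesis by (simp add: Ints_mult)
qed

text \<open>Restriction to the subgroup generated by \<open>g\<close>, which has order
  \<open>d div g\<close>.\<close>

lemma cyclic_rep_multiples:
  assumes "cyclic_rep d I M" "g dvd d"
  shows "cyclic_rep (d div g) I (\<lambda>k. M (g * k))"
proof -
  have "g * (k + d div g) = g * k + d" for k
    using assms(2) by (simp add: distrib_left)
  then show ?thesis using assms unfolding cyclic_rep_def
    by (auto simp: distrib_left dvd_div_eq_0_iff)
qed

text \<open>Moebius inversion over the subgroups. The elements with \<open>gcd k d = e\<close> are
  the generators of the subgroup of multiples of \<open>e\<close>, and that subgroup is the disjoint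
  union of such classes over the multiples \<open>e'\<close> of \<open>e\<close> dividing
  \<open>d\<close>. Induction from large \<open>e\<close> downwards removes the classes with
  \<open>e' \<noteq> e\<close>. The application has \<open>e = 1\<close>; general \<open>e\<close>
  serves the induction.\<close>

lemma sum_gcd_eq_in_Ints:
  fixes t :: "nat \<Rightarrow> 'k::field_char_0"
  assumes d: "d > 0"
    and t: "\<And>g. g dvd d \<Longrightarrow> (\<Sum>k<d div g. t (g * k)) \<in> \<int>"
    and e: "e dvd d"
  shows "(\<Sum>k | k < d \<and> gcd k d = e. t k) \<in> \<int>"
  using e
proof (induction "d - e" arbitrary: e rule: less_induct)
  case (less e)
  define X where "X = {e'. e' dvd d \<and> e dvd e' \<and> e' \<noteq> e}"
  have e0: "e > 0" using less.prems d by (auto intro: Nat.gr0I)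
  have fin: "finite X" unfolding X_def using d by simp
  have "(\<Sum>k<d div e. t (e * k)) = (\<Sum>k | k < d \<and> e dvd k. t k)"
  proof (rule sum.reindex_bij_betw)
    show "bij_betw (\<lambda>k. e * k) {..<d div e} {k. k < d \<and> e dvd k}"
      using less.prems e0
      by (intro bij_betw_byWitness[where f' = "\<lambda>k. k div e"]) (auto simp: div_less_mono)
  qed
  also have "{k. k < d \<and> e dvd k} = (\<Union>e'\<in>insert e X. {k. k < d \<and> gcd k d = e'})"
    using less.prems by (auto simp: X_def)
  also have "sum t \<dots> = (\<Sum>e'\<in>insert e X. \<Sum>k | k < d \<and> gcd k d = e'. t k)"
    using fin by (intro sum.UNION_disjoint) auto
  also have "\<dots> = (\<Sum>k | k < d \<and> gcd k d = e. t k) + (\<Sum>e'\<in>X. \<Sum>k | k < d \<and> gcd k d = e'. t k)"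
    using fin by (subst sum.insert) (auto simp: X_def)
  finally have "(\<Sum>k | k < d \<and> gcd k d = e. t k) =
      (\<Sum>k<d div e. t (e * k)) - (\<Sum>e'\<in>X. \<Sum>k | k < d \<and> gcd k d = e'. t k)"
    unfolding eq_diff_eq by (rule sym)
  moreover have "(\<Sum>e'\<in>X. \<Sum>k | k < d \<and> gcd k d = e'. t k) \<in> \<int>"
  proof (rule Ints_sum)
    fix e' assume e': "e' \<in> X"
    then have "e' > 0" "e' \<le> d" using d by (auto simp: X_def dest: dvd_imp_le intro: Nat.gr0I)
    then have "e < e'" using e' by (auto simp: X_def dest!: dvd_imp_le)
    then show "(\<Sum>k | k < d \<and> gcd k d = e'. t k) \<in> \<int>"
      using e' \<open>e' \<le> d\<close> less.hyps[of e'] by (auto simp: X_def)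
  qed
  ultimately show ?case using t[OF less.prems] by (auto intro: Ints_diff)
qed

section \<open>Tensor powers and bounded denominators\<close>

text \<open>The Kronecker power: its rows and columns are indexed by \<open>N\<close>-tuples, taken
  from \<open>{..<N} \<rightarrow>\<^sub>E I\<close> so that the index set is finite.\<close>

definition tensor_power :: "nat \<Rightarrow> ('i \<Rightarrow> 'i \<Rightarrow> 'k::comm_ring_1) \<Rightarrow> (nat \<Rightarrow> 'i) \<Rightarrow> (nat \<Rightarrow> 'i) \<Rightarrow> 'k" where
  "tensor_power N M f g = (\<Prod>k<N. M (f k) (g k))"

lemma mtrace_tensor_power:
  "finite I \<Longrightarrow> mtrace ({..<N} \<rightarrow>\<^sub>E I) (tensor_power N M) = mtrace I M ^ N"
  unfolding mtrace_def tensor_power_def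
  using prod_sum_PiE[of "{..<N}" "\<lambda>_. I" "\<lambda>_ i. M i i"] by simp

text \<open>Expanding a product of \<open>N\<close> sums over all tuples shows that tensor powers
  are multiplicative.\<close>

lemma cyclic_rep_tensor_power:
  assumes "cyclic_rep d I M"
  shows "cyclic_rep d ({..<N} \<rightarrow>\<^sub>E I) (\<lambda>k. tensor_power N (M k))"
proof -
  have "mmul ({..<N} \<rightarrow>\<^sub>E I) (tensor_power N (M k)) (tensor_power N (M l)) f g
      = tensor_power N (mmul I (M k) (M l)) f g" for k l f g
    using assms
    by (simp add: mmul_def tensor_power_def cyclic_rep_def prod_sum_PiE prod.distrib)
  then show ?thesis using assms
    unfolding cyclic_rep_def tensor_power_def
    by (auto simp: finite_PiE intro!: prod.cong) (metis PiE_mem lessThan_iff)+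
qed

text \<open>The case \<open>N = 1\<close> makes \<open>r\<close> rational. If
  \<open>r = u / v\<close> in lowest terms, every power of \<open>v\<close> divides the fixed number
  \<open>c\<close>, so \<open>v = 1\<close>.\<close>

lemma bounded_denominators_in_Ints:
  fixes r :: "'k::field_char_0"
  assumes c: "c > 0" and N: "\<And>N. of_nat c * r ^ N \<in> \<int>"
  shows "r \<in> \<int>"
proof -
  obtain x :: int where x: "of_nat c * r = of_int x" using N[of 1] by (auto elim: Ints_cases)
  define y where "y = Rat.Fract x (int c)"
  have r: "r = of_rat y" using x c by (simp add: y_def of_rat_rat field_simps)
  obtain u v where uv: "quotient_of y = (u, v)" by fastforce
  have v: "v > 0" "coprime u v" and y: "y = of_int u / of_int v"
    using quotient_of_denom_pos[OF uv] quotient_of_coprime[OF uv] quotient_of_div[OF uv] by auto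
  have dv: "v ^ N dvd int c" for N
  proof -
    obtain m where m: "of_nat c * r ^ N = of_int m" using N[of N] by (auto elim: Ints_cases)
    have "(of_int (int c * u ^ N) :: 'k) = of_int (m * v ^ N)"
      using m v by (simp add: r y of_rat_divide of_rat_power field_simps)
    then have "int c * u ^ N = m * v ^ N" by (simp only: of_int_eq_iff)
    then have "v ^ N dvd int c * u ^ N" by simp
    then show ?thesis using v(2)
      by (metis coprime_commute coprime_dvd_mult_left_iff coprime_power_left_iff coprime_power_right_iff)
  qed
  \<comment> \<open>The exponent \<open>N = c\<close> already suffices, since
    \<open>2 ^ c > c\<close>.\<close>
  have "v = 1"
  proof (rule ccontr)
    assume "v \<noteq> 1"
    then have "2 \<le> v" using v by simp
    then have "2 ^ c \<le> v ^ c" by (intro power_mono) auto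
    also have "\<dots> \<le> int c" using dv[of c] c by (intro zdvd_imp_le) auto
    finally show False using less_exp[of c] by (metis not_le of_nat_le_iff of_nat_numeral of_nat_power)
  qed
  then show ?thesis by (simp add: r y)
qed

text \<open>In the \<open>N\<close>-th tensor power each generator has trace \<open>r ^ N\<close>,
  where \<open>r\<close> is the common trace of the generators. Their sum is an integer, and the
  number of generators does not depend on \<open>N\<close>, so it bounds the denominators of all
  powers of \<open>r\<close>.\<close>

lemma cyclic_rep_mtrace_in_Ints:
  fixes M :: "nat \<Rightarrow> 'i \<Rightarrow> 'i \<Rightarrow> 'k::field_char_0"
  assumes M: "cyclic_rep d I M"
    and gen: "\<And>k. coprime k d \<Longrightarrow> mtrace I (M k) = mtrace I (M 1)"
  shows "mtrace I (M 1) \<in> \<int>"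
proof (rule bounded_denominators_in_Ints)
  let ?U = "{k. k < d \<and> gcd k d = 1}"
  have d: "d > 0" and fin: "finite I" using M by (auto simp: cyclic_rep_def)
  \<comment> \<open>The witness is \<open>1 mod d\<close> because for \<open>d = 1\<close> the only
    generator is 0.\<close>
  have "1 mod d < d" "gcd (1 mod d) d = 1" using d by simp_all
  then have "?U \<noteq> {} \<and> finite ?U" by auto
  then show "card ?U > 0" unfolding card_gt_0_iff .
  fix N
  let ?t = "\<lambda>k. mtrace ({..<N} \<rightarrow>\<^sub>E I) (tensor_power N (M k))"
  have "(\<Sum>k\<in>?U. ?t k) \<in> \<int>"
  proof (rule sum_gcd_eq_in_Ints[OF d])
    fix g assume "g dvd d"
    then show "(\<Sum>k<d div g. ?t (g * k)) \<in> \<int>"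
      by (intro cyclic_rep_sum_mtrace cyclic_rep_multiples[of d _ "\<lambda>k. tensor_power N (M k)"]
          cyclic_rep_tensor_power M)
  qed simp
  also have "(\<Sum>k\<in>?U. ?t k) = (\<Sum>k\<in>?U. mtrace I (M 1) ^ N)"
  proof (intro sum.cong refl)
    fix k assume "k \<in> ?U"
    then have "coprime k d" using coprime_iff_gcd_eq_1 by blast
    then show "?t k = mtrace I (M 1) ^ N" by (simp only: mtrace_tensor_power[OF fin] gen[OF \<open>coprime k d\<close>])
  qed
  finally show "of_nat (card ?U) * mtrace I (M 1) ^ N \<in> \<int>" by simp
qed

section \<open>From matrices to traces of linear maps\<close>

text \<open>With \<open>x = g j\<close> for a basis vector \<open>j\<close>, this says that
  composition of maps becomes multiplication of matrices.\<close>

lemma representation_compose: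
  fixes scale :: "'k::field \<Rightarrow> 'v::ab_group_add \<Rightarrow> 'v"
  assumes "vector_space scale" and S: "module.independent scale S" "finite S"
    and f: "Vector_Spaces.linear scale scale f" "f ` S \<subseteq> module.span scale S"
    and x: "x \<in> module.span scale S"
  shows "module.representation scale S (f x) b =
    (\<Sum>s\<in>S. module.representation scale S (f s) b * module.representation scale S x s)"
proof -
  interpret vector_space scale by fact
  interpret f: Vector_Spaces.linear scale scale f by fact
  have fs: "f s \<in> span S" if "s \<in> S" for s using f(2) that by blast
  have "f x = f (\<Sum>s\<in>S. scale (representation S x s) s)"
    using sum_representation_eq[OF S(1) x S(2) order_refl] by simp
  also have "\<dots> = (\<Sum>s\<in>S. scale (representation S x s) (f s))"
    by (simp add: f.sum f.scale)
  finally have "representation S (f x) b = (\<Sum>s\<in>S. representation S (scale (representation S x s) (f s)) b)"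
    using fs by (simp add: representation_sum[OF S(1)] span_scale)
  also have "\<dots> = (\<Sum>s\<in>S. representation S (f s) b * representation S x s)"
    using fs by (intro sum.cong refl) (simp add: representation_scale[OF S(1)] mult.commute)
  finally show ?thesis .
qed

text \<open>The matrices of the powers of \<open>T\<close> on the span of \<open>S\<close> form a
  representation of the cyclic group of order \<open>d\<close>. Conjugation by \<open>R\<close>
  gives \<open>T\<close> and \<open>T ^^ k\<close> the same trace, so all generators share one
  trace.\<close>

lemma trace_in_Ints_if_conjugate_to_powers:
  fixes scale :: "'k::field_char_0 \<Rightarrow> 'v::ab_group_add \<Rightarrow> 'v" and T :: "'v \<Rightarrow> 'v"
  assumes "vector_space scale" and S: "module.independent scale S" "finite S"
    and T: "Vector_Spaces.linear scale scale T" "T ` S \<subseteq> module.span scale S"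
    and d: "d > 0" "T ^^ d = id"
    and conj: "\<And>k. coprime k d \<Longrightarrow> \<exists>R R'.
       Vector_Spaces.linear scale scale R \<and> R ` S \<subseteq> module.span scale S \<and>
       Vector_Spaces.linear scale scale R' \<and> R' ` S \<subseteq> module.span scale S \<and>
       R \<circ> R' = id \<and> R' \<circ> R = id \<and> R \<circ> T = (T ^^ k) \<circ> R"
  shows "(\<Sum>b\<in>S. module.representation scale S (T b) b) \<in> \<int>"
proof -
  interpret vector_space scale by fact
  define mat where "mat f i j = representation S (f j) i" for f :: "'v \<Rightarrow> 'v" and i j
  have span: "f x \<in> span S" if "Vector_Spaces.linear scale scale f" "f ` S \<subseteq> span S" "x \<in> span S" for f x
  proof -
    interpret f: Vector_Spaces.linear scale scale f by fact
    have "f x \<in> f ` span S" using that(3) by blast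
    also have "f ` span S = span (f ` S)" by (rule f.span_image[symmetric])
    also have "\<dots> \<subseteq> span S" using that(2) by (simp add: span_minimal subspace_span)
    finally show ?thesis .
  qed
  have mat_comp: "mmul S (mat f) (mat g) i j = mat (f \<circ> g) i j"
    if "Vector_Spaces.linear scale scale f" "f ` S \<subseteq> span S" "g ` S \<subseteq> span S" "i \<in> S" "j \<in> S" for f g i j
    using representation_compose[OF assms(1) S that(1,2), of "g j" i] that
    by (auto simp: mmul_def mat_def)
  have tr_comm: "mtrace S (mat (f \<circ> g)) = mtrace S (mat (g \<circ> f))"
    if "Vector_Spaces.linear scale scale f" "f ` S \<subseteq> span S"
      "Vector_Spaces.linear scale scale g" "g ` S \<subseteq> span S" for f g
  proof -
    have "mtrace S (mat (f \<circ> g)) = mtrace S (mmul S (mat f) (mat g))"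
      unfolding mtrace_def by (intro sum.cong refl mat_comp[symmetric] that)
    also have "\<dots> = mtrace S (mmul S (mat g) (mat f))" by (rule mtrace_mmul_commute)
    also have "\<dots> = mtrace S (mat (g \<circ> f))"
      unfolding mtrace_def by (intro sum.cong refl mat_comp that)
    finally show ?thesis .
  qed
  have Tk: "Vector_Spaces.linear scale scale (T ^^ k)" "(T ^^ k) ` S \<subseteq> span S" for k
  proof (induction k)
    case 0
    show "Vector_Spaces.linear scale scale (T ^^ 0)" by (simp add: linear_id)
    show "(T ^^ 0) ` S \<subseteq> span S" by (auto intro: span_base)
  next
    case (Suc k)
    show "Vector_Spaces.linear scale scale (T ^^ Suc k)"
      using Vector_Spaces.linear_compose[OF Suc(1) T(1)] by simp
    show "(T ^^ Suc k) ` S \<subseteq> span S" using Suc(2) span[OF T] by auto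
  qed
  define M where "M k = mat (T ^^ k)" for k
  have "cyclic_rep d S M"
    unfolding cyclic_rep_def M_def
    using mat_comp[OF Tk Tk(2)] S(2) d by (auto simp: funpow_add)
  moreover have "mtrace S (M k) = mtrace S (M 1)" if k: "coprime k d" for k
  proof -
    obtain R R' where R: "Vector_Spaces.linear scale scale R" "R ` S \<subseteq> span S"
      "Vector_Spaces.linear scale scale R'" "R' ` S \<subseteq> span S"
      "R \<circ> R' = id" "R' \<circ> R = id" "R \<circ> T = (T ^^ k) \<circ> R"
      using conj[OF k] by blast
    have lin: "Vector_Spaces.linear scale scale ((T ^^ k) \<circ> R)" by (rule Vector_Spaces.linear_compose[OF R(1) Tk(1)])
    have img: "((T ^^ k) \<circ> R) ` S \<subseteq> span S"
      using R(2) span[OF Tk] by auto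
    \<comment> \<open>In this form one cyclic exchange of factors under the trace moves
      \<open>R'\<close> to the right, where it cancels \<open>R\<close>.\<close>
    have "T = R' \<circ> ((T ^^ k) \<circ> R)"
      using R(6,7) by (metis comp_assoc id_comp)
    then have "mtrace S (mat T) = mtrace S (mat (((T ^^ k) \<circ> R) \<circ> R'))"
      using tr_comm[OF R(3,4) lin img] by simp
    also have "((T ^^ k) \<circ> R) \<circ> R' = T ^^ k" using R(5) by (metis comp_assoc comp_id)
    finally show ?thesis by (simp add: M_def)
  qed
  ultimately have "mtrace S (M 1) \<in> \<int>" by (rule cyclic_rep_mtrace_in_Ints)
  then show ?thesis by (simp add: mtrace_def M_def mat_def)
qed

section \<open>Symmetries of the variables\<close>

lemma surj_forall_iff: "surj g \<Longrightarrow> (\<forall>x. P (g x)) \<longleftrightarrow> (\<forall>x. P x)"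
  by (metis surjD)

lemma lookup_map_key: "inj g \<Longrightarrow> Poly_Mapping.lookup (Poly_Mapping.map_key g v) x = Poly_Mapping.lookup v (g x)"
  by (simp add: Poly_Mapping.map_key.rep_eq)

lemma poly_mapping_sum_monomials: "(\<Sum>x\<in>Poly_Mapping.keys v. Poly_Mapping.single x (Poly_Mapping.lookup v x)) = v"
  by (rule poly_mapping_eqI)
    (auto simp: lookup_sum lookup_single when_def in_keys_iff sum.delta' if_distrib cong: if_cong)

lemma map_key_sum:
  "inj g \<Longrightarrow> Poly_Mapping.map_key g (\<Sum>x\<in>A. v x) = (\<Sum>x\<in>A. Poly_Mapping.map_key g (v x))"
  by (rule poly_mapping_eqI) (simp add: lookup_map_key lookup_sum)

lemma map_key_minus:
  fixes v w :: "'a \<Rightarrow>\<^sub>0 'b::ab_group_add"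
  shows "inj g \<Longrightarrow> Poly_Mapping.map_key g (v - w) = Poly_Mapping.map_key g v - Poly_Mapping.map_key g w"
  by (rule poly_mapping_eqI) (simp add: lookup_map_key lookup_minus)

lemma map_key_frag_cmul:
  "inj g \<Longrightarrow> Poly_Mapping.map_key g (frag_cmul c v) = frag_cmul c (Poly_Mapping.map_key g v)"
  by (rule poly_mapping_eqI) (simp add: lookup_map_key)

lemma lookup_scaleR:
  "Poly_Mapping.lookup (c *\<^sub>R v) x = c *\<^sub>R Poly_Mapping.lookup v x" for v :: "'a \<Rightarrow>\<^sub>0 'b::real_vector"
proof -
  have "finite {i. c *\<^sub>R Poly_Mapping.lookup v i \<noteq> 0}"
    by (rule finite_subset[OF _ finite_keys[of v]]) (auto simp: in_keys_iff)
  then show ?thesis by (simp add: scaleR_poly_mapping_def)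
qed

lemma linear_map_key: "inj g \<Longrightarrow> linear (Poly_Mapping.map_key g :: ('a \<Rightarrow>\<^sub>0 real) \<Rightarrow> _)"
  by (rule linearI) (auto intro!: poly_mapping_eqI simp: lookup_map_key lookup_add lookup_scaleR)

lemma bij_map_key:
  assumes "bij g"
  shows "bij (Poly_Mapping.map_key g)"
proof (rule o_bij)
  have "inj g" "inj (inv g)" using assms by (auto simp: bij_is_inj bij_imp_bij_inv)
  then show "Poly_Mapping.map_key g \<circ> Poly_Mapping.map_key (inv g) = id"
    "Poly_Mapping.map_key (inv g) \<circ> Poly_Mapping.map_key g = id"
    using assms
    by (auto simp: fun_eq_iff lookup_map_key bij_is_surj surj_f_inv_f intro!: poly_mapping_eqI)
qed

section \<open>Renaming variables in series\<close>

text \<open>A choice \<open>s\<close> of one term per factor corresponds to the choice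
  \<open>h (s (\<kappa> i))\<close> in factor \<open>i\<close>. This is a bijection from the choices
  with total exponent \<open>v\<close> to those with total \<open>h v\<close>, and the products of
  coefficients agree.\<close>

lemma series_prod_symmetry:
  fixes h :: "yexp \<Rightarrow> yexp" and G :: "'i \<Rightarrow> 'k::complete_nonarch_field yseries"
  assumes \<kappa>: "bij_betw \<kappa> I I" and h: "bij h" "\<And>s. h (\<Sum>i\<in>I. s i) = (\<Sum>i\<in>I. h (s i))"
    and G: "\<And>i w. i \<in> I \<Longrightarrow> G i (h w) = G (\<kappa> i) w"
  shows "series_prod I G (h v) = series_prod I G v"
proof -
  define \<Phi> where "\<Phi> s = (\<lambda>i\<in>I. h (s (\<kappa> i)))" for s :: "'i \<Rightarrow> yexp"
  define \<Psi> where "\<Psi> s = (\<lambda>i\<in>I. inv h (s (inv_into I \<kappa> i)))" for s :: "'i \<Rightarrow> yexp"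
  let ?S = "\<lambda>v. {s \<in> I \<rightarrow>\<^sub>E UNIV. (\<Sum>i\<in>I. s i) = v}"
  have \<kappa>I: "\<kappa> i \<in> I" "inv_into I \<kappa> i \<in> I" "inv_into I \<kappa> (\<kappa> i) = i" "\<kappa> (inv_into I \<kappa> i) = i"
    if "i \<in> I" for i
    using \<kappa> that by (auto simp: bij_betw_def inv_into_into f_inv_into_f)
  have hh: "h (inv h w) = w" "inv h (h w) = w" for w
    using h(1) by (auto simp: bij_is_surj surj_f_inv_f bij_is_inj)
  have inv: "\<Psi> (\<Phi> s) = s" "\<Phi> (\<Psi> s) = s" if "s \<in> I \<rightarrow>\<^sub>E UNIV" for s
    using that \<kappa>I hh by (auto simp: \<Phi>_def \<Psi>_def fun_eq_iff PiE_def extensional_def)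
  have sum_\<Phi>: "(\<Sum>i\<in>I. \<Phi> s i) = h (\<Sum>i\<in>I. s i)" for s
  proof -
    have "(\<Sum>i\<in>I. \<Phi> s i) = (\<Sum>i\<in>I. h (s (\<kappa> i)))" by (simp add: \<Phi>_def)
    also have "\<dots> = (\<Sum>i\<in>I. h (s i))" by (rule sum.reindex_bij_betw[OF \<kappa>])
    finally show ?thesis by (simp add: h(2))
  qed
  have "bij_betw \<Phi> (?S v) (?S (h v))"
  proof (rule bij_betw_byWitness[where f' = \<Psi>])
    show "\<Phi> ` ?S v \<subseteq> ?S (h v)" using sum_\<Phi> by (auto simp: \<Phi>_def)
    show "\<Psi> ` ?S (h v) \<subseteq> ?S v"
    proof safe
      fix s assume s: "s \<in> I \<rightarrow>\<^sub>E UNIV" "(\<Sum>i\<in>I. s i) = h v"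
      then have "h (\<Sum>i\<in>I. \<Psi> s i) = h v" using sum_\<Phi>[of "\<Psi> s"] inv by simp
      then show "(\<Sum>i\<in>I. \<Psi> s i) = v" by (metis hh(2))
    qed (simp_all add: \<Psi>_def)
  qed (use inv in auto)
  then have "series_prod I G (h v) = (\<Sum>\<^sub>\<infinity>s\<in>?S v. \<Prod>i\<in>I. G i (\<Phi> s i))"
    unfolding series_prod_def by (rule infsum_reindex_bij_betw[symmetric])
  also have "\<dots> = (\<Sum>\<^sub>\<infinity>s\<in>?S v. \<Prod>i\<in>I. G i (s i))"
  proof (rule infsum_cong)
    fix s
    have "(\<Prod>i\<in>I. G i (\<Phi> s i)) = (\<Prod>i\<in>I. G (\<kappa> i) (s (\<kappa> i)))"
      by (intro prod.cong refl) (simp add: \<Phi>_def G)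
    then show "(\<Prod>i\<in>I. G i (\<Phi> s i)) = (\<Prod>i\<in>I. G i (s i))"
      by (simp add: prod.reindex_bij_betw[OF \<kappa>, of "\<lambda>i. G i (s i)"])
  qed
  finally show ?thesis by (simp add: series_prod_def)
qed

text \<open>Pulling exponents back along a bijection \<open>g\<close> sends the variable with index
  \<open>x\<close> to the one with index \<open>g x\<close>, so the action is covariant in
  \<open>g\<close>.\<close>

definition relabel :: "(nat \<times> nat \<Rightarrow> nat \<times> nat) \<Rightarrow> 'k yseries \<Rightarrow> 'k yseries" where
  "relabel g \<xi> = (\<lambda>v. \<xi> (Poly_Mapping.map_key g v))"

lemma relabel_id: "relabel id = id"
  by (auto simp: relabel_def fun_eq_iff Poly_Mapping.map_key_id id_def)

lemma relabel_comp:
  assumes "inj g" "inj g'"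
  shows "relabel g \<circ> relabel g' = relabel (g \<circ> g')"
  using assms by (auto simp: relabel_def fun_eq_iff Poly_Mapping.map_key_compose)

lemma relabel_funpow: "inj g \<Longrightarrow> relabel g ^^ k = relabel (g ^^ k)"
  by (induction k) (simp_all add: relabel_id[unfolded id_def] relabel_comp inj_fn id_def)

lemma linear_relabel: "Vector_Spaces.linear series_scale series_scale (relabel g)"
  by unfold_locales (auto simp: relabel_def series_scale_def)

text \<open>
  A permutation \<open>g\<close> of the variables \<open>y\<^sub>i\<^sub>,\<^sub>j\<close> that carries the \<open>l\<close>-th summand of \<open>G\<close> to the
  \<open>\<kappa> l\<close>-th one.
\<close>

locale variable_symmetry =
  fixes n :: nat and d :: "nat \<Rightarrow> nat" and g :: "nat \<times> nat \<Rightarrow> nat \<times> nat" and \<kappa> :: "nat \<Rightarrow> nat"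
  assumes bij: "bij g"
    and index: "g x \<in> (SIGMA i:{..<n}. {..<d i}) \<longleftrightarrow> x \<in> (SIGMA i:{..<n}. {..<d i})"
    and \<kappa>: "bij_betw \<kappa> {..<lcm_d n d} {..<lcm_d n d}"
    and summand: "i < n \<Longrightarrow> g (i, l mod d i) = (i, \<kappa> l mod d i)"
begin

abbreviation act :: "(nat \<times> nat \<Rightarrow>\<^sub>0 'b::zero) \<Rightarrow> (nat \<times> nat \<Rightarrow>\<^sub>0 'b)" where
  "act \<equiv> Poly_Mapping.map_key g"

lemma inj: "inj g"
  using bij by (rule bij_is_inj)

lemma inj_act: "act v = act w \<longleftrightarrow> v = w"
  using bij_map_key[OF bij] by (auto dest: bij_is_inj injD)

lemma act_in_yexps_iff: "act v \<in> yexps n d \<longleftrightarrow> v \<in> yexps n d"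
proof -
  let ?I = "SIGMA i:{..<n}. {..<d i}"
  have "(\<forall>x. g x \<in> Poly_Mapping.keys v \<longrightarrow> g x \<in> ?I) \<longleftrightarrow> (\<forall>x. x \<in> Poly_Mapping.keys v \<longrightarrow> x \<in> ?I)"
    by (rule surj_forall_iff[OF bij_is_surj[OF bij]])
  then have "g -` Poly_Mapping.keys v \<subseteq> ?I \<longleftrightarrow> Poly_Mapping.keys v \<subseteq> ?I"
    unfolding index by blast
  then show ?thesis by (simp only: yexps_def Poly_Mapping.keys_map_key[OF inj] mem_Collect_eq)
qed

text \<open>On exponents \<open>act\<close> is composition with \<open>g\<close>, so it runs against
  \<open>g\<close> and takes the \<open>\<kappa> l\<close>-th summand back to the
  \<open>l\<close>-th.\<close>

lemma act_sub_exp: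
  assumes "Poly_Mapping.keys u \<subseteq> {..<n}"
  shows "act (sub_exp d (\<kappa> l) u) = sub_exp d l u"
  unfolding sub_exp_def map_key_sum[OF inj]
proof (intro sum.cong refl)
  fix i assume "i \<in> Poly_Mapping.keys u"
  then have "(i, \<kappa> l mod d i) = g (i, l mod d i)" using assms summand by auto
  then show "act (Poly_Mapping.single (i, \<kappa> l mod d i) (Poly_Mapping.lookup u i)) =
      Poly_Mapping.single (i, l mod d i) (Poly_Mapping.lookup u i)"
    by (simp only: Poly_Mapping.map_key_single[OF inj])
qed

lemma fps_at_monomial_act: "fps_at_monomial b c (act e) (act v) = fps_at_monomial b c e v"
  by (simp add: fps_at_monomial_def inj_act flip: map_key_frag_cmul[OF inj])

text \<open>\<open>act\<close> commutes with multiplication of exponents by \<open>c\<close>, hence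
  maps the fibre over \<open>w\<close> bijectively onto the fibre over \<open>act w\<close>.\<close>

lemma series_subst_act:
  assumes "\<And>v. \<xi> (act v) = \<xi> v"
  shows "series_subst (yexps n d) (frag_cmul c) \<xi> (act w) = series_subst (yexps n d) (frag_cmul c) \<xi> w"
proof -
  have "{v \<in> yexps n d. frag_cmul c v = w} = act -` {v \<in> yexps n d. frag_cmul c v = act w}"
    by (auto simp: act_in_yexps_iff inj_act simp flip: map_key_frag_cmul[OF inj])
  then have "bij_betw act {v \<in> yexps n d. frag_cmul c v = w} {v \<in> yexps n d. frag_cmul c v = act w}"
    by (simp only: bij_betw_def inj_on_def inj_act surj_image_vimage_eq[OF bij_is_surj[OF bij_map_key[OF bij]]])
      simp
  then show ?thesis
    unfolding series_subst_def using sum.reindex_bij_betw[of act _ _ \<xi>] by (simp add: assms)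
qed

section \<open>Invariance of \<open>F\<close> and commutation with \<alpha>\<close>

context
  fixes f :: "xexp \<Rightarrow>\<^sub>0 'f::field"
  assumes f: "\<forall>u\<in>Poly_Mapping.keys f. Poly_Mapping.keys u \<subseteq> {..<n}"
begin

text \<open>The factor \<open>(l, u)\<close> turns into the factor \<open>(\<kappa> l, u)\<close>;
  both carry the same Teichmueller coefficient, which depends on \<open>u\<close> alone.\<close>

lemma F_series_act: "F_series p q n d f red \<gamma> (act v) = F_series p q n d f red \<gamma> v"
  unfolding F_series_def
proof (rule series_prod_symmetry[where \<kappa> = "map_prod \<kappa> id"])
  show "bij_betw (map_prod \<kappa> id) ({..<lcm_d n d} \<times> Poly_Mapping.keys f) ({..<lcm_d n d} \<times> Poly_Mapping.keys f)"
    by (intro bij_betw_map_prod \<kappa> bij_betw_id)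
next
  fix i w assume "i \<in> {..<lcm_d n d} \<times> Poly_Mapping.keys f"
  then obtain l u where lu: "i = (l, u)" "u \<in> Poly_Mapping.keys f" by blast
  then have "sub_exp d l u = act (sub_exp d (\<kappa> l) u)" using act_sub_exp[of u l] f by simp
  then show "(case i of (l, u) \<Rightarrow> fps_at_monomial (theta p \<gamma>)
        (teichmueller q red (Poly_Mapping.lookup f u)) (sub_exp d l u)) (act w)
    = (case map_prod \<kappa> id i of (l, u) \<Rightarrow> fps_at_monomial (theta p \<gamma>)
        (teichmueller q red (Poly_Mapping.lookup f u)) (sub_exp d l u)) w"
    by (simp add: lu fps_at_monomial_act)
qed (simp_all add: bij_map_key[OF bij] map_key_sum[OF inj])

text \<open>Each Frobenius twist of \<open>F\<close> is invariant by itself, since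
  \<open>\<tau>\<close> acts on coefficients only; hence no factors are permuted.\<close>

lemma F_a_series_act: "F_a_series p a n d f red \<gamma> \<tau> (act v) = F_a_series p a n d f red \<gamma> \<tau> v"
  unfolding F_a_series_def
proof (rule series_prod_symmetry[where \<kappa> = id])
  fix m and w :: yexp
  let ?G = "\<lambda>m. series_subst (yexps n d) (frag_cmul (int (p ^ m)))
    (\<lambda>v. (\<tau> ^^ m) (F_series p (p ^ a) n d f red \<gamma> v))"
  have "?G m (act w) = ?G m w" by (rule series_subst_act) (simp only: F_series_act)
  then show "?G m (act w) = ?G (id m) w" by simp
qed (simp_all add: bij_map_key[OF bij] map_key_sum[OF inj])

text \<open>Invariance of \<open>F_a_series\<close> allows the substitution of \<open>act w\<close>
  for \<open>w\<close> in the convolution, and \<open>act\<close> commutes with multiplication of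
  exponents by \<open>p ^ a\<close>.\<close>

lemma alpha_relabel: "alpha p a n d f red \<gamma> \<tau> (relabel g \<xi>) = relabel g (alpha p a n d f red \<gamma> \<tau> \<xi>)"
proof
  fix u :: yexp
  let ?F = "F_a_series p a n d f red \<gamma> \<tau>" and ?v = "frag_cmul (int (p ^ a)) u"
  have "alpha p a n d f red \<gamma> \<tau> (relabel g \<xi>) u = (\<Sum>\<^sub>\<infinity>w. ?F (act w) * \<xi> (act ?v - act w))"
    by (simp only: alpha_def psi_def series_mult_def relabel_def F_a_series_act map_key_minus[OF inj])
  also have "\<dots> = (\<Sum>\<^sub>\<infinity>w. ?F w * \<xi> (act ?v - w))"
    by (rule infsum_reindex_bij_betw[OF bij_map_key[OF bij]])
  also have "\<dots> = relabel g (alpha p a n d f red \<gamma> \<tau> \<xi>) u"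
    by (simp only: alpha_def psi_def series_mult_def relabel_def map_key_frag_cmul[OF inj])
  finally show "alpha p a n d f red \<gamma> \<tau> (relabel g \<xi>) u = relabel g (alpha p a n d f red \<gamma> \<tau> \<xi>) u" .
qed

section \<open>Invariance of the polytope, the weight, \<open>B\<close> and the generalized
  eigenspaces\<close>

lemma act_G_exps: "act ` G_exps n d f = G_exps n d f"
proof -
  have "act ` G_exps n d f = (\<Union>l\<in>\<kappa> ` {..<lcm_d n d}. act ` sub_exp d l ` Poly_Mapping.keys f)"
    using \<kappa> by (simp add: G_exps_def image_UN bij_betw_def)
  also have "\<dots> = (\<Union>l<lcm_d n d. (\<lambda>u. act (sub_exp d (\<kappa> l) u)) ` Poly_Mapping.keys f)"
    by (simp add: image_image)
  also have "\<dots> = G_exps n d f"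
    unfolding G_exps_def using f act_sub_exp by (intro SUP_cong image_cong refl) auto
  finally show ?thesis .
qed

lemma act_real_exp: "act (real_exp u) = real_exp (act u)"
  by (simp add: real_exp_def Poly_Mapping.map_key_map[OF inj])

lemma act_Delta: "act ` Delta n d f = Delta n d f"
proof -
  have "act ` insert 0 (real_exp ` G_exps n d f) = insert 0 (real_exp ` act ` G_exps n d f)"
    by (simp add: Poly_Mapping.map_key_zero[OF inj] image_image act_real_exp)
  then show ?thesis
    by (simp add: Delta_def convex_hull_linear_image[OF linear_map_key[OF inj]] act_G_exps)
qed

text \<open>The cone and the weight are both defined through these memberships, so both inherit the
  invariance.\<close>

lemma act_in_scaled_Delta_iff:
  "real_exp (act u) \<in> (*\<^sub>R) c ` Delta n d f \<longleftrightarrow> real_exp u \<in> (*\<^sub>R) c ` Delta n d f"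
proof -
  have "(*\<^sub>R) c ` Delta n d f = (*\<^sub>R) c ` act ` Delta n d f" by (simp add: act_Delta)
  also have "\<dots> = act ` (*\<^sub>R) c ` Delta n d f"
    by (simp add: image_image linear_scale[OF linear_map_key[OF inj]])
  finally have "real_exp (act u) \<in> (*\<^sub>R) c ` Delta n d f \<longleftrightarrow> act (real_exp u) \<in> act ` (*\<^sub>R) c ` Delta n d f"
    by (simp add: act_real_exp)
  also have "\<dots> \<longleftrightarrow> real_exp u \<in> (*\<^sub>R) c ` Delta n d f"
    by (rule inj_image_mem_iff) (simp add: inj_on_def inj_act)
  finally show ?thesis .
qed

lemma act_in_cone_points_iff: "act u \<in> cone_points (Delta n d f) \<longleftrightarrow> u \<in> cone_points (Delta n d f)"
  by (simp add: cone_points_def act_in_scaled_Delta_iff)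

lemma weight_act: "weight (Delta n d f) (act u) = weight (Delta n d f) u"
  by (simp add: weight_def act_in_scaled_Delta_iff)

text \<open>The normalized coefficients become \<open>A (act u)\<close>: equal weights keep the
  power of \<open>\<pi>\<close>, and injectivity of \<open>act\<close> keeps the decay
  condition.\<close>

lemma relabel_in_B_space:
  assumes "\<xi> \<in> B_space (Delta n d f) D \<pi>"
  shows "relabel g \<xi> \<in> B_space (Delta n d f) D \<pi>"
proof -
  obtain A where A: "\<forall>u\<in>cone_points (Delta n d f). \<xi> u = A u * \<pi> ^ nat \<lfloor>real D * weight (Delta n d f) u\<rfloor>"
    "\<forall>u. u \<notin> cone_points (Delta n d f) \<longrightarrow> \<xi> u = 0"
    "\<forall>\<epsilon>>0. finite {u \<in> cone_points (Delta n d f). \<epsilon> \<le> vabs (A u)}"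
    using assms by (auto simp: B_space_def)
  have "finite {u \<in> cone_points (Delta n d f). \<epsilon> \<le> vabs (A (act u))}" if "\<epsilon> > 0" for \<epsilon>
  proof -
    have "finite (act -` {u \<in> cone_points (Delta n d f). \<epsilon> \<le> vabs (A u)})"
      using A(3) that by (intro finite_vimageI) (auto simp: inj_on_def inj_act)
    then show ?thesis by (simp add: vimage_def act_in_cone_points_iff)
  qed
  then show ?thesis
    unfolding B_space_def relabel_def
    using A by (intro CollectI exI[of _ "\<lambda>u. A (act u)"]) (auto simp: act_in_cone_points_iff weight_act)
qed

lemma relabel_in_gen_eigenspace:
  fixes \<xi> :: "'k::complete_nonarch_field yseries" and red :: "'k \<Rightarrow> 'f"
  assumes "\<xi> \<in> gen_eigenspace (alpha p a n d f red \<gamma> \<tau>) (B_space (Delta n d f) D \<pi>) c"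
  shows "relabel g \<xi> \<in> gen_eigenspace (alpha p a n d f red \<gamma> \<tau>) (B_space (Delta n d f) D \<pi>) c"
proof -
  let ?T = "\<lambda>\<eta>. alpha p a n d f red \<gamma> \<tau> \<eta> - series_scale c \<eta>"
  have "?T (relabel g \<eta>) = relabel g (?T \<eta>)" for \<eta>
    unfolding alpha_relabel by (simp add: relabel_def series_scale_def fun_eq_iff)
  then have comm: "(?T ^^ k) (relabel g \<eta>) = relabel g ((?T ^^ k) \<eta>)" for k \<eta>
    by (induction k) simp_all
  obtain k where "(?T ^^ k) \<xi> = 0" using assms unfolding gen_eigenspace_def by blast
  then have "(?T ^^ k) (relabel g \<xi>) = 0"
    unfolding comm by (simp add: relabel_def fun_eq_iff)
  then show ?thesis
    using assms relabel_in_B_space unfolding gen_eigenspace_def by blast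
qed

end

end

section \<open>The multiplicative symmetries and the shift\<close>

text \<open>Being the identity off the index set makes this a bijection of the whole type when
  \<open>k\<close> is invertible modulo \<open>lcm_d n d\<close>.\<close>

definition power_perm :: "nat \<Rightarrow> (nat \<Rightarrow> nat) \<Rightarrow> nat \<Rightarrow> nat \<times> nat \<Rightarrow> nat \<times> nat" where
  "power_perm n d k = (\<lambda>(i, j). if i < n \<and> j < d i then (i, k * j mod d i) else (i, j))"

definition shift_perm :: "nat \<Rightarrow> (nat \<Rightarrow> nat) \<Rightarrow> nat \<times> nat \<Rightarrow> nat \<times> nat" where
  "shift_perm n d = (\<lambda>(i, j). if i < n \<and> j < d i then (i, (j + 1) mod d i) else (i, j))"

lemma dvd_lcm_d: "i < n \<Longrightarrow> d i dvd lcm_d n d"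
  unfolding lcm_d_def by (rule dvd_Lcm) simp

lemma lcm_d_pos: "\<forall>i<n. 1 \<le> d i \<Longrightarrow> lcm_d n d > 0"
  unfolding lcm_d_def by (rule Nat.gr0I) (auto simp: Lcm_0_iff)

lemma funpow_shift_perm:
  "(shift_perm n d ^^ m) (i, j) = (if i < n \<and> j < d i then (i, (j + m) mod d i) else (i, j))"
  by (induction m) (auto simp: shift_perm_def mod_Suc_eq)

lemma funpow_shift_perm_lcm_d: "shift_perm n d ^^ lcm_d n d = id"
proof
  fix x :: "nat \<times> nat"
  obtain i j where x: "x = (i, j)" by force
  show "(shift_perm n d ^^ lcm_d n d) x = id x"
    using dvd_lcm_d[of i n d] by (auto simp: x funpow_shift_perm elim!: dvdE)
qed

text \<open>A congruence modulo the lcm descends to every \<open>d i\<close>. Writing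
  \<open>1 mod lcm_d n d\<close> covers the case where the lcm is 1.\<close>

lemma power_perm_inverse:
  assumes "k * k' mod lcm_d n d = 1 mod lcm_d n d"
  shows "power_perm n d k \<circ> power_perm n d k' = id"
proof
  fix x :: "nat \<times> nat"
  obtain i j where x: "x = (i, j)" by force
  have "k * k' * j mod d i = j" if "i < n" "j < d i"
  proof -
    have "k * k' mod d i = 1 mod d i"
      using assms dvd_lcm_d[OF that(1)] by (metis mod_mod_cancel)
    then have "k * k' * j mod d i = 1 * j mod d i" by (metis mod_mult_left_eq)
    then show ?thesis using that by simp
  qed
  then show "(power_perm n d k \<circ> power_perm n d k') x = id x"
    by (auto simp: x power_perm_def mod_mult_right_eq mult.assoc)
qed

text \<open>The identity \<open>k * (j + 1) = k * j + k\<close> is what conjugates \<sigma> into its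
  \<open>k\<close>-th power.\<close>

lemma power_perm_shift_perm:
  "power_perm n d k \<circ> shift_perm n d = (shift_perm n d ^^ k) \<circ> power_perm n d k"
  by (auto simp: fun_eq_iff funpow_shift_perm power_perm_def)
    (auto simp: shift_perm_def mod_mult_right_eq mod_add_right_eq distrib_left add.commute)

lemma variable_symmetry_shift_perm:
  assumes "\<forall>i<n. 1 \<le> d i"
  shows "variable_symmetry n d (shift_perm n d) (\<lambda>l. (l + 1) mod lcm_d n d)"
proof
  let ?L = "lcm_d n d"
  have L: "?L > 0" using lcm_d_pos[OF assms] .
  \<comment> \<open>Splitting one factor off the \<open>?L\<close>-th power exhibits the power
    \<open>?L - 1\<close> as a two-sided inverse of the shift.\<close>
  then have "shift_perm n d ^^ Suc (?L - 1) = id" using funpow_shift_perm_lcm_d by simp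
  then have "(shift_perm n d ^^ (?L - 1)) \<circ> shift_perm n d = id"
    "shift_perm n d \<circ> (shift_perm n d ^^ (?L - 1)) = id"
    unfolding funpow_Suc_right[symmetric] funpow.simps(2)[symmetric] by assumption+
  then show "bij (shift_perm n d)" by (rule o_bij)
  show "shift_perm n d x \<in> (SIGMA i:{..<n}. {..<d i}) \<longleftrightarrow> x \<in> (SIGMA i:{..<n}. {..<d i})" for x
    by (cases x) (auto simp: shift_perm_def intro!: mod_less_divisor)
  show "bij_betw (\<lambda>l. (l + 1) mod ?L) {..<?L} {..<?L}"
  proof (rule bij_betw_byWitness[where f' = "\<lambda>l. (l + (?L - 1)) mod ?L"])
    have inv: "((l + a) mod ?L + b) mod ?L = l" if "a + b = ?L" "l < ?L" for a b l
      using that by (simp add: mod_add_left_eq add.assoc)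
    have "1 + (?L - 1) = ?L" "(?L - 1) + 1 = ?L" using L by simp_all
    then show "\<forall>l\<in>{..<?L}. ((l + 1) mod ?L + (?L - 1)) mod ?L = l"
      "\<forall>l\<in>{..<?L}. ((l + (?L - 1)) mod ?L + 1) mod ?L = l"
      unfolding Ball_def lessThan_iff using inv by blast+
  qed (use L in auto)
  show "shift_perm n d (i, l mod d i) = (i, (l + 1) mod ?L mod d i)" if "i < n" for i l
    using that assms dvd_lcm_d[OF that, of d]
    by (auto simp: shift_perm_def mod_mod_cancel mod_Suc_eq)
qed

lemma variable_symmetry_power_perm:
  assumes d: "\<forall>i<n. 1 \<le> d i" and k: "k * k' mod lcm_d n d = 1 mod lcm_d n d"
  shows "variable_symmetry n d (power_perm n d k) (\<lambda>l. k * l mod lcm_d n d)"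
proof
  let ?L = "lcm_d n d"
  have L: "?L > 0" using lcm_d_pos[OF d] .
  have k': "k' * k mod ?L = 1 mod ?L" using k by (simp add: mult.commute)
  show "bij (power_perm n d k)"
    using power_perm_inverse[OF k'] power_perm_inverse[OF k] by (rule o_bij)
  show "power_perm n d k x \<in> (SIGMA i:{..<n}. {..<d i}) \<longleftrightarrow> x \<in> (SIGMA i:{..<n}. {..<d i})" for x
    by (cases x) (auto simp: power_perm_def intro!: mod_less_divisor)
  show "bij_betw (\<lambda>l. k * l mod ?L) {..<?L} {..<?L}"
  proof (rule bij_betw_byWitness[where f' = "\<lambda>l. k' * l mod ?L"])
    have *: "a * (b * l mod ?L) mod ?L = l" if "a * b mod ?L = 1 mod ?L" "l < ?L" for a b l
    proof -
      have "a * (b * l mod ?L) mod ?L = (a * b) * l mod ?L"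
        by (simp only: mod_mult_right_eq mult.assoc)
      also have "\<dots> = (a * b mod ?L) * l mod ?L" by (simp only: mod_mult_left_eq)
      also have "\<dots> = l" using that(2) by (simp add: that(1) mod_mult_left_eq)
      finally show ?thesis .
    qed
    show "\<forall>l\<in>{..<?L}. k' * (k * l mod ?L) mod ?L = l" "\<forall>l\<in>{..<?L}. k * (k' * l mod ?L) mod ?L = l"
      unfolding Ball_def lessThan_iff using *[OF k] *[OF k'] by blast+
  qed (use L in auto)
  show "power_perm n d k (i, l mod d i) = (i, k * l mod ?L mod d i)" if "i < n" for i l
    using that d dvd_lcm_d[OF that, of d]
    by (auto simp: power_perm_def mod_mod_cancel mod_mult_right_eq)
qed

section \<open>Supports in \<open>B\<close>, \<sigma> as a renaming, and the integrality of its
  trace\<close>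

lemma keys_real_exp: "Poly_Mapping.keys (real_exp v) = Poly_Mapping.keys v"
  by (auto simp: real_exp_def Poly_Mapping.map.rep_eq in_keys_iff when_def)

text \<open>The vectors supported on the index set form a subspace containing 0 and the exponents of
  \<open>G\<close>, hence also the polytope and its cone. This is needed because
  \<open>sigma_op\<close> discards coefficients outside \<open>yexps n d\<close>, whereas
  \<open>relabel\<close> keeps them.\<close>

lemma B_space_support:
  assumes f: "\<forall>u\<in>Poly_Mapping.keys f. Poly_Mapping.keys u \<subseteq> {..<n}" and d: "\<forall>i<n. 1 \<le> d i"
    and \<xi>: "\<xi> \<in> B_space (Delta n d f) D \<pi>" and v: "v \<notin> yexps n d"
  shows "\<xi> v = 0"
proof -
  let ?I = "SIGMA i:{..<n}. {..<d i}"
  let ?W = "{w :: nat \<times> nat \<Rightarrow>\<^sub>0 real. Poly_Mapping.keys w \<subseteq> ?I}"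
  have W: "?W = {w. \<forall>x. x \<notin> ?I \<longrightarrow> Poly_Mapping.lookup w x = 0}"
    by (auto simp: in_keys_iff)
  have "Poly_Mapping.keys w \<subseteq> ?I" if G: "w \<in> G_exps n d f" for w
  proof -
    obtain l u where u: "u \<in> Poly_Mapping.keys f" and w: "w = sub_exp d l u"
      using G unfolding G_exps_def by blast
    show ?thesis
    proof (rule subsetI)
      fix x assume "x \<in> Poly_Mapping.keys w"
      then have "x \<in> (\<Union>i\<in>Poly_Mapping.keys u.
          Poly_Mapping.keys (Poly_Mapping.single (i, l mod d i) (Poly_Mapping.lookup u i)))"
        unfolding w sub_exp_def by (rule subsetD[OF Poly_Mapping.keys_sum])
      then obtain i where i: "i \<in> Poly_Mapping.keys u" "x = (i, l mod d i)"
        by (auto split: if_splits)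
      then have "i < n" using f u by blast
      then have "d i > 0" using d by (simp add: Suc_le_eq)
      then show "x \<in> ?I" using i(2) \<open>i < n\<close> by simp
    qed
  qed
  then have "insert 0 (real_exp ` G_exps n d f) \<subseteq> ?W"
    by (simp add: image_subset_iff keys_real_exp)
  moreover have "convex ?W"
    unfolding W convex_def by (simp add: lookup_add lookup_scaleR)
  ultimately have "Delta n d f \<subseteq> ?W" unfolding Delta_def by (rule hull_minimal)
  moreover have "real_exp v \<notin> (*\<^sub>R) c ` ?W" for c
  proof
    assume "real_exp v \<in> (*\<^sub>R) c ` ?W"
    then have "real_exp v \<in> ?W" unfolding W by (auto simp: lookup_scaleR)
    then show False using v by (simp add: yexps_def keys_real_exp)
  qed
  ultimately have "v \<notin> cone_points (Delta n d f)" unfolding cone_points_def by blast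
  then show ?thesis using \<xi> by (auto simp: B_space_def)
qed

text \<open>On \<open>yexps n d\<close> the map \<open>act\<close> inverts
  \<open>shift_exp d\<close>, so the fibre sum has the single term at \<open>act w\<close>; at other
  exponents both sides vanish.\<close>

lemma sigma_op_eq_relabel:
  assumes d: "\<forall>i<n. 1 \<le> d i" and \<xi>: "\<And>v. v \<notin> yexps n d \<Longrightarrow> \<xi> v = 0"
  shows "sigma_op n d \<xi> = relabel (shift_perm n d) \<xi>"
proof
  fix w
  interpret variable_symmetry n d "shift_perm n d" "\<lambda>l. (l + 1) mod lcm_d n d"
    using d by (rule variable_symmetry_shift_perm)
  have act_shift: "act (shift_exp d v) = v" if v: "v \<in> yexps n d" for v
  proof -
    have "shift_exp d v = (\<Sum>x\<in>Poly_Mapping.keys v. Poly_Mapping.single (shift_perm n d x) (Poly_Mapping.lookup v x))"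
      unfolding shift_exp_def using v by (intro sum.cong refl) (auto simp: yexps_def shift_perm_def)
    then have "act (shift_exp d v) = (\<Sum>x\<in>Poly_Mapping.keys v. Poly_Mapping.single x (Poly_Mapping.lookup v x))"
      by (simp add: map_key_sum[OF inj] Poly_Mapping.map_key_single[OF inj])
    then show ?thesis by (simp add: poly_mapping_sum_monomials)
  qed
  show "sigma_op n d \<xi> w = relabel (shift_perm n d) \<xi> w"
  proof (cases "w \<in> yexps n d")
    case True
    then have "act (shift_exp d (act w)) = act w" by (intro act_shift) (simp add: act_in_yexps_iff)
    then have "shift_exp d (act w) = w" by (simp add: inj_act)
    then have "{v \<in> yexps n d. shift_exp d v = w} = {act w}"
      using True act_in_yexps_iff act_shift by auto
    then show ?thesis by (simp add: sigma_op_def series_subst_def relabel_def)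
  next
    case False
    then have "shift_exp d v \<noteq> w" if "v \<in> yexps n d" for v
      using act_in_yexps_iff[of "shift_exp d v"] act_shift[OF that] that by auto
    then have empty: "{v \<in> yexps n d. shift_exp d v = w} = {}" by blast
    have "\<xi> (act w) = 0" using False by (intro \<xi>) (simp add: act_in_yexps_iff)
    then show ?thesis by (simp only: sigma_op_def series_subst_def relabel_def empty sum.empty)
  qed
qed

theorem theorem7p1:
  fixes p a q n D :: nat
    and d :: "nat \<Rightarrow> nat"
    and f :: "(nat \<Rightarrow>\<^sub>0 int) \<Rightarrow>\<^sub>0 'f::{field, finite}"
    and red :: "'k::complete_nonarch_field \<Rightarrow> 'f"
    and \<gamma> \<pi> lam :: 'k
    and \<tau> :: "'k \<Rightarrow> 'k"
    and \<Delta> :: "(nat \<times> nat \<Rightarrow>\<^sub>0 real) set"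
    and B :: "'k yseries set"
    and \<alpha> :: "'k yseries \<Rightarrow> 'k yseries"
  assumes "prime p" and "q = p ^ a" and "CARD('f) = q"
    and "\<forall>u\<in>Poly_Mapping.keys f. Poly_Mapping.keys u \<subseteq> {..<n}"
    and "\<forall>i<n. 1 \<le> d i"
    and "vabs (of_nat p :: 'k) = 1 / real p"
    and "is_reduction q red"
    and "(\<lambda>i. \<gamma> ^ (p ^ i) / of_nat (p ^ i)) sums 0"
    and "vabs \<gamma> = real p powr (- (1 / (real p - 1)))"
    and "\<Delta> = Delta n d f"
    and "1 \<le> D" and "\<forall>u\<in>cone_points \<Delta>. real D * weight \<Delta> u \<in> \<int>"
    and "\<pi> ^ D = \<gamma>"
    and "is_frobenius p q \<pi> \<tau>"
    and "B = B_space \<Delta> D \<pi>"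
    and "\<alpha> = alpha p a n d f red \<gamma> \<tau>"
    and "lam \<noteq> 0" and "is_eigenvalue \<alpha> B lam"
  shows "trace_on (sigma_op n d) (gen_eigenspace \<alpha> B lam) \<in> \<int>"
proof -
  note f = assms(4) and d = assms(5)
  have B: "B = B_space (Delta n d f) D \<pi>" using assms(10,15) by (simp only:)
  define V where "V = gen_eigenspace \<alpha> B lam"
  \<comment> \<open>This is literally the basis chosen inside \<open>trace_on\<close>, so the trace
    unfolds to a sum over \<open>S\<close>.\<close>
  define S where "S = (SOME S. S \<subseteq> V \<and> series.independent S \<and> V \<subseteq> series.span S)"
  have "\<exists>S. S \<subseteq> V \<and> series.independent S \<and> V \<subseteq> series.span S"
    by (rule series.maximal_independent_subset[of V]) blast
  then have "S \<subseteq> V \<and> series.independent S \<and> V \<subseteq> series.span S"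
    unfolding S_def by (rule someI_ex)
  then have S: "S \<subseteq> V" "series.independent S" "V \<subseteq> series.span S" by simp_all
  let ?s = "shift_perm n d" and ?L = "lcm_d n d"
  have V_sym: "relabel g ` S \<subseteq> series.span S" if "variable_symmetry n d g \<kappa>" for g \<kappa>
  proof -
    have "relabel g b \<in> V" if "b \<in> V" for b
      using variable_symmetry.relabel_in_gen_eigenspace[OF \<open>variable_symmetry n d g \<kappa>\<close> f] that
      unfolding V_def B assms(16) .
    then show ?thesis using S(1,3) by blast
  qed
  have sym_s: "variable_symmetry n d ?s (\<lambda>l. (l + 1) mod ?L)"
    using d by (rule variable_symmetry_shift_perm)
  have inj_s: "inj ?s" by (rule variable_symmetry.inj[OF sym_s])
  have "sigma_op n d b = relabel ?s b" if "b \<in> S" for b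
  proof (rule sigma_op_eq_relabel[OF d])
    have "b \<in> B_space (Delta n d f) D \<pi>" using that S(1) B by (auto simp: V_def gen_eigenspace_def)
    then show "b v = 0" if "v \<notin> yexps n d" for v using B_space_support[OF f d] that by blast
  qed
  then have "trace_on (sigma_op n d) V = (\<Sum>b\<in>S. series.representation S (relabel ?s b) b)"
    by (simp add: trace_on_def flip: S_def)
  also have "\<dots> \<in> \<int>"
  proof (cases "finite S")
    case True
    show ?thesis
    proof (rule trace_in_Ints_if_conjugate_to_powers[OF series.vector_space_axioms S(2) True linear_relabel
          V_sym[OF sym_s] lcm_d_pos[OF d]])
      show "relabel ?s ^^ ?L = id"
        by (simp add: relabel_funpow[OF inj_s] funpow_shift_perm_lcm_d relabel_id)
    next
      fix k assume "coprime k ?L"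
      \<comment> \<open>The inverse of \<open>k\<close> modulo the lcm supplies the inverse renaming
        \<open>R'\<close>.\<close>
      then obtain k' where "[k * k' = Suc 0] (mod ?L)" using cong_solve_coprime_nat by blast
      then have k: "k * k' mod ?L = 1 mod ?L" by (simp add: cong_def)
      then have k': "k' * k mod ?L = 1 mod ?L" by (simp add: mult.commute)
      note sym = variable_symmetry_power_perm[OF d k] variable_symmetry_power_perm[OF d k']
      note inj = variable_symmetry.inj[OF sym(1)] variable_symmetry.inj[OF sym(2)]
      show "\<exists>R R'. Vector_Spaces.linear series_scale series_scale R \<and> R ` S \<subseteq> series.span S \<and>
          Vector_Spaces.linear series_scale series_scale R' \<and> R' ` S \<subseteq> series.span S \<and>
          R \<circ> R' = id \<and> R' \<circ> R = id \<and> R \<circ> relabel ?s = (relabel ?s ^^ k) \<circ> R"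
      proof (intro exI conjI)
        show "relabel (power_perm n d k) \<circ> relabel (power_perm n d k') = id"
          by (simp add: relabel_comp inj power_perm_inverse[OF k] relabel_id)
        show "relabel (power_perm n d k') \<circ> relabel (power_perm n d k) = id"
          by (simp add: relabel_comp inj power_perm_inverse[OF k'] relabel_id)
        show "relabel (power_perm n d k) \<circ> relabel ?s = (relabel ?s ^^ k) \<circ> relabel (power_perm n d k)"
          by (simp add: relabel_comp inj inj_s inj_fn relabel_funpow power_perm_shift_perm)
      qed (rule linear_relabel V_sym[OF sym(1)] V_sym[OF sym(2)])+
    qed
  qed simp \<comment> \<open>for infinite \<open>S\<close> the sum is 0 by convention\<close>
  finally show ?thesis by (simp add: V_def)
qed

end
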